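(* Let $X$ be a primitive strongly regular graph with parameters $(v,k,a,c)$ and $v\geq 5$, and let $k>\theta>0>\tau$ be the eigenvalues of its adjacency matrix $A(X)$. Then there exist $x,y\in\mathbb{C}$ such that $W=I+xA(X)+yA(\overline{X})$ is a complex Hadamard matrix if and only if $X$ or $\overline{X}$ has one of the following parameter sets: (i) $(4\theta^2,\,2\theta^2-\theta,\,\theta^2-\theta,\,\theta^2-\theta)$; (ii) $(4\theta^2,\,2\theta^2+\theta,\,\theta^2+\theta,\,\theta^2+\theta)$; (iii) $(4\theta^2-1,\,2\theta^2,\,\theta^2,\,\theta^2)$; (iv) $(4\theta^2+4\theta+1,\,2\theta^2+2\theta,\,\theta^2+\theta-1,\,\theta^2+\theta)$; (v) $(4\theta^2+4\theta+2,\,2\theta^2+\theta,\,\theta^2-1,\,\theta^2)$.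
   Context: A strongly regular graph with parameters $(v,k,a,c)$ is a non-complete $k$-regular graph on $v$ vertices in which any two adjacent vertices have exactly $a$ common neighbours and any two distinct non-adjacent vertices have exactly $c$ common neighbours. $\overline{X}$ denotes the complement; $X$ is primitive if $X$ and $\overline{X}$ are connected. Besides $k$, $A(X)$ has eigenvalues $\theta\geq\tau$, the roots of $z^2-(a-c)z-(k-c)=0$. An $n\times n$ complex matrix $W$ is a complex Hadamard matrix if every entry has absolute value $1$ and $W\overline{W}^T=nI$. *)

theory Defs
  imports "HOL-Analysis.Analysis"
begin

text \<open>
  A finite simple graph is given by its adjacency relation on a finite vertex type \<open>'n\<close>,
  so that it has \<open>CARD('n)\<close> vertices and its matrices are indexed by the vertices themselves.
\<close>

definition simple_graph :: "('n \<Rightarrow> 'n \<Rightarrow> bool) \<Rightarrow> bool" where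
  "simple_graph X \<longleftrightarrow> symp X \<and> irreflp X"

definition complement_graph :: "('n \<Rightarrow> 'n \<Rightarrow> bool) \<Rightarrow> 'n \<Rightarrow> 'n \<Rightarrow> bool" where
  "complement_graph X u w \<longleftrightarrow> u \<noteq> w \<and> \<not> X u w"

definition connected_graph :: "('n \<Rightarrow> 'n \<Rightarrow> bool) \<Rightarrow> bool" where
  "connected_graph X \<longleftrightarrow> (\<forall>u w. X\<^sup>*\<^sup>* u w)"

definition primitive_graph :: "('n \<Rightarrow> 'n \<Rightarrow> bool) \<Rightarrow> bool" where
  "primitive_graph X \<longleftrightarrow> connected_graph X \<and> connected_graph (complement_graph X)"

definition strongly_regular ::
    "('n::finite \<Rightarrow> 'n \<Rightarrow> bool) \<Rightarrow> nat \<Rightarrow> nat \<Rightarrow> nat \<Rightarrow> nat \<Rightarrow> bool" where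
  "strongly_regular X v k a c \<longleftrightarrow>
     simple_graph X \<and>
     CARD('n) = v \<and>
     (\<exists>u w. u \<noteq> w \<and> \<not> X u w) \<and>
     (\<forall>u. card {z. X u z} = k) \<and>
     (\<forall>u w. X u w \<longrightarrow> card {z. X u z \<and> X w z} = a) \<and>
     (\<forall>u w. u \<noteq> w \<and> \<not> X u w \<longrightarrow> card {z. X u z \<and> X w z} = c)"

definition adjacency_matrix :: "('n::finite \<Rightarrow> 'n \<Rightarrow> bool) \<Rightarrow> complex^'n^'n" where
  "adjacency_matrix X = (\<chi> u w. if X u w then 1 else 0)"

definition eigenvalues :: "complex^'n^'n \<Rightarrow> complex set" where
  "eigenvalues A = {z. \<exists>u. u \<noteq> 0 \<and> A *v u = z *s u}"

definition srg_eigenvalues :: "('n::finite \<Rightarrow> 'n \<Rightarrow> bool) \<Rightarrow> nat \<Rightarrow> real \<Rightarrow> real \<Rightarrow> bool" where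
  "srg_eigenvalues X k \<theta> \<tau> \<longleftrightarrow>
     eigenvalues (adjacency_matrix X) = {of_nat k, of_real \<theta>, of_real \<tau>} \<and>
     real k > \<theta> \<and> \<theta> > 0 \<and> 0 > \<tau>"

definition complex_hadamard :: "complex^'n^'n \<Rightarrow> bool" where
  "complex_hadamard W \<longleftrightarrow>
     (\<forall>i j. norm (W $ i $ j) = 1) \<and>
     W ** transpose (map_matrix cnj W) = mat (of_nat CARD('n))"

text \<open>
  In \<open>listed_parameters \<theta> v k a c\<close> the number \<open>\<theta>\<close> is meant to be the positive eigenvalue other
  than \<open>k\<close> of the graph that has the parameters \<open>(v, k, a, c)\<close>. It need not be an integer: for
  the pentagon, which is of the fourth kind, it is irrational.
\<close>

definition listed_parameters :: "real \<Rightarrow> nat \<Rightarrow> nat \<Rightarrow> nat \<Rightarrow> nat \<Rightarrow> bool" where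
  "listed_parameters \<theta> v k a c \<longleftrightarrow>
     (real v, real k, real a, real c) \<in>
       {(4*\<theta>^2, 2*\<theta>^2 - \<theta>, \<theta>^2 - \<theta>, \<theta>^2 - \<theta>),
        (4*\<theta>^2, 2*\<theta>^2 + \<theta>, \<theta>^2 + \<theta>, \<theta>^2 + \<theta>),
        (4*\<theta>^2 - 1, 2*\<theta>^2, \<theta>^2, \<theta>^2),
        (4*\<theta>^2 + 4*\<theta> + 1, 2*\<theta>^2 + 2*\<theta>, \<theta>^2 + \<theta> - 1, \<theta>^2 + \<theta>),
        (4*\<theta>^2 + 4*\<theta> + 2, 2*\<theta>^2 + \<theta>, \<theta>^2 - 1, \<theta>^2)}"

end

(*
  Comparing the entries of W W* with those of vI, W is a complex Hadamard matrix iff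
  |x| = |y| = 1 and p = Re x, q = Re y, r = Re (x conj y) satisfy two linear equations. Such x, y
  exist only if the Gram determinant 1 - p^2 - q^2 - r^2 + 2pqr vanishes. Put s = 1 - r,
  P = k - 1 - a and Q = k - c; the linear equations express p and q by s, and since r = 1 would
  force p < -1, the cubic reduces to 2 - 2pq = s + (Q - P)^2 s with 0 < s <= 2. Complementation
  exchanges P and Q, so assume P <= Q. With n = v - 1 and l = n - k, counting gives
  P k + Q l = k l <= n^2/4, which bounds n from below in terms of P, while the equation for s
  bounds it from above. This rules out Q >= P + 2 and leaves n = 4P or 4P + 1 if Q = P, and
  n = 4P + 2 or 4P + 3 if Q = P + 1. A quadratic equation then determines k; one spurious root is
  excluded because v and k cannot both be odd. Conversely, y = 1 works for the first three
  families, and y = conj x for the last two.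
*)
theory Submission
  imports Defs
begin

section \<open>Arithmetic of the parameters\<close>

text \<open>The purely numerical core of the forward direction, with \<open>p\<close>,
  \<open>q\<close>, \<open>r\<close> in the roles of Re x, Re y and Re (x conj y). Primed parameters
  are those of the complement, whose positive non-principal eigenvalue is
  \<open>- 1 - \<tau>\<close>. The hypothesis \<open>c \<le> a + 1\<close> is the normalisation P <=
  Q.\<close>

lemma listed_of_hadamard_equations:
  fixes v k a c k' a' c' :: nat and \<theta> \<tau> p q r :: real
  assumes sum: "\<theta> + \<tau> = real a - real c" and prod: "\<theta> * \<tau> = real c - real k"
    and sgn: "\<theta> > 0" "\<tau> < 0"
    and compl: "k' = v - 1 - k" "v + c = a' + 2 + 2 * k" "v + a = c' + 2 * k"
    and nat: "k < v - 1" "0 < k" "0 < c" "5 \<le> v" "c \<le> a + 1"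
    and count: "real k * (real k - 1 - real a) = (real v - 1 - real k) * real c"
    and ev: "even (v * k)"
    and bnd: "\<bar>p\<bar> \<le> 1" "\<bar>q\<bar> \<le> 1" "\<bar>r\<bar> \<le> 1"
    and gram: "1 - p\<^sup>2 - q\<^sup>2 - r\<^sup>2 + 2 * p * q * r = 0"
    and adj: "2 * p + v - 2 * k + 2 * a + 2 * (real k - 1 - a) * r = 0"
    and nonadj: "2 * q + v - 2 - 2 * k + 2 * c + 2 * (real k - c) * r = 0"
  shows "listed_parameters \<theta> v k a c \<or> listed_parameters (- 1 - \<tau>) v k' a' c'"
proof -
  \<comment> \<open>These are integers, so that real bounds on \<open>n\<close> leave only finitely
    many values relative to \<open>P\<close>; they also avoid truncated subtraction.\<close>
  define P Q l n where "P = int k - 1 - int a" and "Q = int k - int c"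
    and "l = int v - 1 - int k" and "n = int v - 1"
  define s where "s = 1 - r"
  have r: "r = 1 - s" by (simp add: s_def)
  have l0: "0 < l" and n: "n = k + l" and n4: "4 \<le> n" using nat by (auto simp: l_def n_def)
  have PQ: "real_of_int P = real k - 1 - a" "real_of_int Q = real k - c"
    "real_of_int l = real v - 1 - k" "real_of_int n = real v - 1"
    by (auto simp: P_def Q_def l_def n_def)
  then have vac: "real v = n + 1" "real a = real k - 1 - P" "real c = real k - Q" by simp_all
  have "real_of_int (k * P) = real_of_int (l * c)" using count by (simp add: PQ)
  then have kP: "int k * P = l * c" by (simp only: of_int_eq_iff)
  then have P0: "0 < P" using nat l0
    by (metis of_nat_0_less_iff zero_less_mult_iff less_asym)
  have key: "P * k + l * Q = k * l" using kP by (simp add: Q_def algebra_simps)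
  have PleQ: "P \<le> Q" using nat by (simp add: P_def Q_def)
  have "s \<noteq> 0"
  proof
    assume "s = 0"
    then have "2 * p + real v - 2 = 0" using adj by (simp add: r algebra_simps)
    then show False using bnd nat by linarith
  qed
  then have s0: "0 < s" and s2: "s \<le> 2" using bnd by (auto simp: s_def)
  have p: "2 * p = 2 * P * s + 1 - n" using adj by (simp add: r PQ algebra_simps)
  have q: "2 * q = 2 * Q * s + 1 - n" using nonadj by (simp add: r PQ algebra_simps)
  have qp: "q - p = (Q - P) * s" using p q by (simp add: algebra_simps)
  \<comment> \<open>With r = 1 - s the Gram determinant equals 2s - s^2 - 2pqs - (q - p)^2. By
    \<open>qp\<close> the last square also contains the factor s, which can then be
    cancelled.\<close>
  have "s * (2 - 2 * p * q) = s * (s + (Q - P) * (q - p))"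
    using gram arg_cong[OF qp, of "\<lambda>t. t * (q - p)"] unfolding r
    by (simp add: algebra_simps power2_eq_square)
  then have quad: "2 - 2 * p * q = s + (Q - P) * (q - p)" using s0 by simp
  have four: "4 * (x * y) \<le> (x + y)\<^sup>2" for x y :: int
    using zero_le_power2[of "x - y"] by (simp add: power2_eq_square algebra_simps)
  have \<theta>\<tau>: "\<theta> * \<tau> = - Q" "\<theta> + \<tau> = Q - P - 1" using sum prod by (auto simp: PQ)
  consider "P = Q" | "Q = P + 1" | "P + 2 \<le> Q" using PleQ by linarith
  then show ?thesis
  proof cases
    case 1
    then have \<tau>: "\<tau> = - 1 - \<theta>" using \<theta>\<tau> by simp
    then have P\<theta>: "real_of_int P = \<theta>\<^sup>2 + \<theta>" using \<theta>\<tau>(1) 1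
      unfolding \<open>\<tau> = - 1 - \<theta>\<close> by (simp add: power2_eq_square algebra_simps)
    then have Q\<theta>: "real_of_int Q = \<theta>\<^sup>2 + \<theta>" using 1 by simp
    have "p = q" using qp 1 by simp
    then have s: "s = 2 - 2 * p\<^sup>2" using quad by (simp add: power2_eq_square)
    have root: "4 * P * p\<^sup>2 + 2 * p + (n - 4 * P - 1) = 0"
      using p unfolding s by (simp add: algebra_simps)
    have "4 * P * n \<le> n * n" using four[of k l] key 1 n by (simp add: algebra_simps power2_eq_square)
    then have "4 * P \<le> n" using n4 by simp
    moreover have "n \<le> 4 * P + 1"
    \<comment> \<open>If n >= 4P + 2, then by P >= 1 the left side of \<open>root\<close> is at
      least 4p^2 + 2p + 1, which is positive for every real p.\<close>
    proof (rule ccontr)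
      assume "\<not> ?thesis"
      then have "1 \<le> real_of_int (n - 4 * P - 1)" by linarith
      then have "4 * P * p\<^sup>2 + 2 * p + 1 \<le> 0" using root by linarith
      moreover have "4 * p\<^sup>2 \<le> 4 * P * p\<^sup>2" using P0 by (simp add: mult_right_mono)
      moreover have "0 < 4 * p\<^sup>2 + 2 * p + 1" 
        using zero_le_power2[of "2 * p + 1 / 2"] by (simp add: power2_eq_square algebra_simps)
      ultimately show False by linarith
    qed
    ultimately consider "n = 4 * P" | "n = 4 * P + 1" by linarith
    then show ?thesis
    proof cases
      \<comment> \<open>The quadratic for \<open>k\<close> has a double root, which gives the
        conference graph parameters of the fourth family.\<close>
      case 11: 1
      have l: "l = 4 * P - k" using n 11 by simp
      have "(int k - 2 * P)\<^sup>2 = 0" using key 1 unfolding l by (simp add: power2_eq_square algebra_simps)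
      then have "int k = 2 * P" by simp
      then have "real k = 2 * P" by (metis of_int_of_nat_eq)
      then have "listed_parameters \<theta> v k a c"
        unfolding listed_parameters_def vac 11 by (simp add: P\<theta> Q\<theta>)
      then show ?thesis ..
    next
      case 12: 2
      have "l = 4 * P + 1 - k" using n 12 by simp
      then have "real_of_int l = 4 * P + 1 - k" by simp
      moreover have "P * k + real_of_int l * P = k * real_of_int l" using key 1 
        by (metis of_int_add of_int_mult of_int_of_nat_eq)
      ultimately have "(real k - (2 * P - \<theta>)) * (real k - (2 * P + \<theta> + 1)) = 0"
        using P\<theta> by (simp add: power2_eq_square) (algebra)
      then consider "real k = 2 * P - \<theta>" | "real k = 2 * P + \<theta> + 1" by auto
      then show ?thesis
      proof cases
        case 121: 1
        then have "listed_parameters \<theta> v k a c"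
          unfolding listed_parameters_def vac 12 by (simp add: P\<theta> Q\<theta>)
        then show ?thesis ..
      next
        \<comment> \<open>The two roots for \<open>k\<close> add up to n, so this one is the degree
          of the complement of a graph of the fifth family. Here \<open>- 1 - \<tau>\<close> is
          again \<open>\<theta>\<close>.\<close>
        case 122: 2
        have "real k' = real v - 1 - k" "real a' = real v - 2 - 2 * real k + c" "real c' = real v - 2 * real k + a"
          using compl nat by linarith+
        then have "listed_parameters (- 1 - \<tau>) v k' a' c'" using 122
          unfolding listed_parameters_def vac 12 \<tau> by (simp add: P\<theta> Q\<theta>)
        then show ?thesis ..
      qed
    qed
  next
    case 2
    then have \<tau>: "\<tau> = - \<theta>" using \<theta>\<tau> by simp
    then have Q\<theta>: "real_of_int Q = \<theta>\<^sup>2" using \<theta>\<tau>(1)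
      unfolding \<open>\<tau> = - \<theta>\<close> by (simp add: power2_eq_square)
    have P\<theta>: "real_of_int P = \<theta>\<^sup>2 - 1" using Q\<theta> 2 by simp
    have pq: "q = p + s" using qp 2 by simp
    have "(p + 1) * (q - 1) = 0" using quad 2 pq by (simp add: algebra_simps)
    then have "n \<le> 4 * P + 3"
    \<comment> \<open>If p = -1 then n = 2Ps + 3, and if q = 1 then n = 2Qs - 1. Since s <= 2 and Q
      = P + 1, both are at most 4P + 3.\<close>
    proof -
      have "P * s \<le> real_of_int P * 2" using s2 P0 by (intro mult_left_mono) auto
      moreover have "Q * s \<le> real_of_int Q * 2" using s2 P0 PleQ by (intro mult_left_mono) auto
      moreover have "p = - 1 \<or> q = 1" using \<open>(p + 1) * (q - 1) = 0\<close> by auto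
      ultimately have "real_of_int n \<le> 4 * P + 3" using p q 2 by (auto simp: algebra_simps)
      then show ?thesis by linarith
    qed
    moreover have P': "P * n = (int k - 1) * l" using key n 2 by (simp add: algebra_simps)
    \<comment> \<open>The factors k - 1 and l of P n add up to n - 1, so 4Pn <= (n - 1)^2; this is
      incompatible with 4P >= n - 1.\<close>
    have "4 * P \<le> n - 2"
    proof (rule ccontr)
      assume "\<not> ?thesis"
      then have "n - 1 \<le> 4 * P" by simp
      then have "(n - 1) * n \<le> 4 * (P * n)" using n4 by (simp add: mult_right_mono mult.assoc[symmetric])
      also have "\<dots> \<le> (n - 1)\<^sup>2" using four[of "int k - 1" l] P' n by (simp add: algebra_simps)
      finally show False using n4 by (simp add: power2_eq_square)
    qed
    ultimately consider "n = 4 * P + 2" | "n = 4 * P + 3" by linarith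
    then have "listed_parameters \<theta> v k a c"
    proof cases
      case 21: 1
      have l: "l = 4 * P + 2 - k" using n 21 by simp
      have "(int k - (2 * P + 1)) * (int k - (2 * P + 2)) = 0" using P' 21 unfolding l
        by (simp add: algebra_simps)
      then have "int k = 2 * P + 1 \<or> int k = 2 * P + 2" by auto
      moreover have "int k \<noteq> 2 * P + 1"
      proof
        assume "int k = 2 * P + 1"
        then have "odd (int k)" by simp
        moreover have "int v = 2 * (2 * P + 1) + 1" using 21 by (simp add: n_def)
        then have "odd (int v)" by simp
        ultimately show False using ev by simp
      qed
      ultimately have "int k = 2 * P + 2" by simp
      then have "real k = 2 * P + 2" by (metis of_int_of_nat_eq of_int_add of_int_mult of_int_numeral)
      then show ?thesis unfolding listed_parameters_def vac 21 by (simp add: P\<theta> Q\<theta>)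
    next
      case 22: 2
      have "l = 4 * P + 3 - k" using n 22 by simp
      then have "real_of_int l = 4 * P + 3 - k" by simp
      moreover have "real_of_int (P * n) = real_of_int ((int k - 1) * l)" using P' by simp
      then have "P * (4 * real_of_int P + 3) = (real k - 1) * l" using 22 by simp
      ultimately have "(real k - (2 * P + 2 - \<theta>)) * (real k - (2 * P + 2 + \<theta>)) = 0"
        using P\<theta> by (simp add: power2_eq_square) (algebra)
      then have "real k = 2 * P + 2 - \<theta> \<or> real k = 2 * P + 2 + \<theta>" by auto
      then show ?thesis unfolding listed_parameters_def vac 22 by (auto simp: P\<theta> Q\<theta>)
    qed
    then show ?thesis ..
  next
    case 3
    \<comment> \<open>In this case 1 + (Q - P)^2 >= 5 while 2 - 2pq <= 4, whence s <= 4/5. With p >=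
      -1 and 4P <= n this gives n - 3 <= 2n/5, so n <= 5; only k = 4, l = 1 remains, and
      \<open>key\<close> refutes it.\<close>
    have "(Q - P) * s \<le> 2" using qp bnd by linarith
    have "1 + (1::int) * 4 \<le> 1 + (Q - P)\<^sup>2" using 3 power_mono[of 2 "Q - P" 2] by simp
    then have "5 \<le> real_of_int (1 + (Q - P)\<^sup>2)" by linarith
    then have "5 * s \<le> real_of_int (1 + (Q - P)\<^sup>2) * s" using s0 by (intro mult_right_mono) auto
    also have "\<dots> = 2 - 2 * (p * q)" using quad qp by (simp add: algebra_simps power2_eq_square)
    also have "\<dots> \<le> 4" using mult_mono[of "\<bar>p\<bar>" 1 "\<bar>q\<bar>" 1] bnd by (simp add: abs_mult[symmetric] abs_le_iff)
    finally have s: "s \<le> 4 / 5" by simp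
    have "P * n \<le> int k * l"
      using key n mult_left_mono[OF PleQ less_imp_le[OF l0]] by (simp add: algebra_simps)
    then have "4 * P * n \<le> n * n" using four[of k l] n by (simp add: power2_eq_square)
    then have "4 * P \<le> n" using n4 by simp
    have "P * s \<le> P * (4 / 5)" using s P0 by (intro mult_left_mono) auto
    moreover have "n - 3 \<le> 2 * (P * s)" using p bnd by simp
    ultimately have "n \<le> 5" using \<open>4 * P \<le> n\<close> by linarith
    moreover have "4 \<le> int k" using 3 P0 nat by (simp add: Q_def)
    ultimately have "l = 1" using n l0 by simp
    then have "P * k + Q = k" using key by simp
    moreover have "1 * int k \<le> P * k" using P0 by (intro mult_right_mono) auto
    ultimately have False using P0 PleQ by linarith
    then show ?thesis ..
  qed
qed

section \<open>Adjacency matrices, complementation and degree sums\<close>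

lemma adjacency_matrix_mult_nth:
  "(adjacency_matrix X *v f) $ u = (\<Sum>z\<in>UNIV. of_bool (X u z) * f $ z)"
  unfolding adjacency_matrix_def matrix_vector_mult_def by (simp add: of_bool_def)

lemma complement_mult_nth:
  assumes "simple_graph X"
  shows "(adjacency_matrix (complement_graph X) *v f) $ u
    = (\<Sum>z\<in>UNIV. f $ z) - f $ u - (adjacency_matrix X *v f) $ u"
proof -
  have "(adjacency_matrix (complement_graph X) *v f) $ u
    = (\<Sum>z\<in>UNIV. f $ z - of_bool (z = u) * f $ z - of_bool (X u z) * f $ z)"
    unfolding adjacency_matrix_mult_nth using assms
    by (intro sum.cong) (auto simp: complement_graph_def simple_graph_def irreflp_def)
  then show ?thesis
    by (simp add: sum_subtractf adjacency_matrix_mult_nth)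
qed

lemma complement_involution:
  assumes "simple_graph X"
  shows "complement_graph (complement_graph X) = X"
  using assms by (auto simp: complement_graph_def simple_graph_def irreflp_def fun_eq_iff)

text \<open>The handshake lemma, for induced subgraphs so that induction on \<open>S\<close>
  applies: a new vertex contributes its degree once itself and once more through its
  neighbours.\<close>

lemma even_sum_degrees:
  assumes "simple_graph X" "finite S"
  shows "even (\<Sum>u\<in>S. card {z \<in> S. X u z})"
  using assms(2)
proof (induction S)
  case (insert x S)
  have sym: "X u x = X x u" and irr: "\<not> X x x" for u
    using assms(1) by (auto simp: simple_graph_def symp_def irreflp_def)
  have *: "{z \<in> insert x S. X x z} = {z \<in> S. X x z}" using irr by auto
  have "card {z \<in> insert x S. X u z} = of_bool (X x u) + card {z \<in> S. X u z}" for u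
  proof -
    have "{z \<in> insert x S. X u z} = (if X x u then {x} else {}) \<union> {z \<in> S. X u z}"
      using sym by auto
    then show ?thesis using insert by simp
  qed
  then have "(\<Sum>u\<in>insert x S. card {z \<in> insert x S. X u z})
    = 2 * card {z \<in> S. X x z} + (\<Sum>u\<in>S. card {z \<in> S. X u z})"
    using insert irr by (simp add: * sum.distrib Int_def)
  then show ?case using insert by simp
qed simp

section \<open>The form of W and of the entries of its Gram matrix\<close>

text \<open>The left side is what expanding one entry of W W* produces, with \<open>x'\<close>,
  \<open>y'\<close> standing for the conjugates of unit numbers. \<open>D\<close> marks the diagonal
  and \<open>E\<close> the edges; in each of the three cases the terms collect around x x' and y y',
  which are 1.\<close>

lemma hadamard_gram_polynomial:
  fixes x y x' y' v k a c :: "'a::comm_ring_1"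
  assumes "x * x' = 1" "y * y' = 1" "\<not> (D \<and> E)"
  shows "y * y' * v + y * (1 - y') + y * (x' - y') * k + (1 - y) * y'
      + (1 - y) * (1 - y') * of_bool D + (1 - y) * (x' - y') * of_bool E + (x - y) * y' * k
      + (x - y) * (1 - y') * of_bool E
      + (x - y) * (x' - y') * (c + (a - c) * of_bool E + (k - c) * of_bool D)
    = (if D then v
       else if E then x + x' + v - 2 * k + 2 * a + (k - 1 - a) * (x * y' + y * x')
       else y + y' + v - 2 - 2 * k + 2 * c + (k - c) * (x * y' + y * x'))"
    (is "?L = _")
proof -
  consider D "\<not> E" | "\<not> D" E | "\<not> D" "\<not> E" using assms(3) by blast
  then show ?thesis
  proof cases
    case 1
    then have "?L = (y * y') * (v - 1 - k) + 1 + (x * x') * k" by (simp add: algebra_simps)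
    then show ?thesis using 1 assms by simp
  next
    case 2
    then have "?L = x + x' + (y * y') * (v - 2 * k + a) + (x * x') * a + (k - 1 - a) * (x * y' + y * x')"
      by (simp add: algebra_simps)
    then show ?thesis using 2 assms by simp
  next
    case 3
    then have "?L = y + y' + (y * y') * (v - 2 - 2 * k + c) + (x * x') * c + (k - c) * (x * y' + y * x')"
      by (simp add: algebra_simps)
    then show ?thesis using 3 assms by simp
  qed
qed

text \<open>For strongly regular X these are the elements of the Bose-Mesner algebra, spanned by I
  and the two adjacency matrices, whose coefficient at I is 1.\<close>

definition scheme_matrix :: "('n::finite \<Rightarrow> 'n \<Rightarrow> bool) \<Rightarrow> complex \<Rightarrow> complex \<Rightarrow> complex^'n^'n" where
  "scheme_matrix X x y = mat 1 + map_matrix ((*) x) (adjacency_matrix X)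
     + map_matrix ((*) y) (adjacency_matrix (complement_graph X))"

section \<open>Strongly regular graphs: counting and spectrum\<close>

locale srg =
  fixes X :: "'n::finite \<Rightarrow> 'n \<Rightarrow> bool" and v k a c :: nat
  assumes srg: "strongly_regular X v k a c"
begin

lemma simple: "simple_graph X" and card_vertices: "CARD('n) = v"
  and degree: "card {z. X u z} = k"
  and nonedge: "\<exists>u w. u \<noteq> w \<and> \<not> X u w"
  using srg by (auto simp: strongly_regular_def)

lemma sym: "X u w \<longleftrightarrow> X w u" and irrefl: "\<not> X u u"
  using simple by (auto simp: simple_graph_def symp_def irreflp_def)

lemma sum_adjacent: "(\<Sum>z\<in>UNIV. of_bool (X u z)) = (of_nat k :: 'a::comm_ring_1)"
  "(\<Sum>z\<in>UNIV. of_bool (X z u)) = (of_nat k :: 'a::comm_ring_1)"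
  using degree[of u] sym[of _ u] by simp_all

text \<open>The entrywise form of A^2 = cJ + (a - c)A + (k - c)I, with J the all-one matrix.
  Indicator sums in this shape can be summed further without case distinctions.\<close>

lemma sum_common:
  "(\<Sum>z\<in>UNIV. of_bool (X u z) * of_bool (X w z)) =
    of_nat c + (of_nat a - of_nat c) * of_bool (X u w) + ((of_nat k - of_nat c) * of_bool (u = w) :: 'a::comm_ring_1)"
proof -
  have "(\<Sum>z\<in>UNIV. of_bool (X u z) * of_bool (X w z)) = (of_nat (card {z. X u z \<and> X w z}) :: 'a)"
    by (simp flip: of_bool_conj)
  also have "card {z. X u z \<and> X w z} = (if u = w then k else if X u w then a else c)"
    using srg by (auto simp: strongly_regular_def)
  finally show ?thesis using irrefl by auto
qed

text \<open>Sum one row of A^2 in two ways: as k^2 by regularity, and by the formula in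
  \<open>sum_common\<close>.\<close>

lemma count: "real k * (real k - 1 - real a) = (real v - 1 - real k) * real c"
proof -
  fix u
  have "(\<Sum>w\<in>UNIV. \<Sum>z\<in>UNIV. of_bool (X u z) * of_bool (X w z)) = real k * real k"
    by (subst sum.swap) (simp add: sum_adjacent flip: sum_distrib_left sum_distrib_right)
  moreover have "(\<Sum>w\<in>UNIV. \<Sum>z\<in>UNIV. of_bool (X u z) * of_bool (X w z))
    = v * c + (real a - c) * k + (real k - c)"
    unfolding sum_common sum.distrib sum_distrib_left[symmetric] sum_adjacent
    by (simp add: card_vertices)
  ultimately show ?thesis by (simp add: algebra_simps)
qed

lemma even_vertices_degree: "even (v * k)"
  using even_sum_degrees[OF simple, of UNIV] by (simp add: degree card_vertices)

lemma degree_less: "k < v - 1"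
proof -
  obtain u w where uw: "u \<noteq> w" "\<not> X u w" using nonedge by blast
  then have "{z. X u z} \<subseteq> UNIV - {u, w}" using irrefl by auto
  then have "k \<le> card (UNIV - {u, w})" unfolding degree[of u, symmetric] by (rule card_mono[rotated]) simp
  also have "\<dots> = v - 2" using uw by (simp add: card_Diff_subset card_vertices)
  \<comment> \<open>That v is at least 2 has to be supplied, because the subtractions are
    truncated.\<close>
  finally show ?thesis using card_mono[of UNIV "{u, w}"] uw by (simp add: card_vertices)
qed

lemma adjacency_matrix_square_mult_nth:
  "(adjacency_matrix X *v (adjacency_matrix X *v f)) $ u =
    of_nat c * (\<Sum>z\<in>UNIV. f $ z) + (of_nat a - of_nat c) * (adjacency_matrix X *v f) $ u
      + (of_nat k - of_nat c) * f $ u"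
proof -
  have "(adjacency_matrix X *v (adjacency_matrix X *v f)) $ u
    = (\<Sum>w\<in>UNIV. \<Sum>z\<in>UNIV. of_bool (X u z) * of_bool (X w z) * f $ w)"
    unfolding adjacency_matrix_mult_nth sum_distrib_left
    by (subst sum.swap) (simp add: sym mult.assoc)
  also have "\<dots> = (\<Sum>w\<in>UNIV. of_nat c * f $ w + (of_nat a - of_nat c) * (of_bool (X u w) * f $ w)
      + (of_nat k - of_nat c) * (of_bool (u = w) * f $ w))"
    unfolding sum_distrib_right[symmetric] sum_common by (simp add: algebra_simps)
  finally show ?thesis
    unfolding sum.distrib sum_distrib_left[symmetric] adjacency_matrix_mult_nth by simp
qed

lemma sum_adjacency_matrix_mult:
  "(\<Sum>u\<in>UNIV. (adjacency_matrix X *v f) $ u) = of_nat k * (\<Sum>z\<in>UNIV. f $ z)"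
  unfolding adjacency_matrix_mult_nth
  by (subst sum.swap) (simp add: sum_adjacent sum_distrib_left flip: sum_distrib_right)

text \<open>All column sums of A are k, so adding up the coordinates of Af = zf gives k times the
  sum on one side and z times it on the other.\<close>

lemma eigenvector_sum:
  assumes "adjacency_matrix X *v f = z *s f" "z \<noteq> of_nat k"
  shows "(\<Sum>u\<in>UNIV. f $ u) = 0"
  using assms sum_adjacency_matrix_mult[of f] by (simp flip: sum_distrib_left)

text \<open>J annihilates a vector with sum zero, so the identity for A^2 becomes a scalar equation
  at any nonzero coordinate. Assuming the zero sum instead of z different from k allows a later use
  at z = k.\<close>

lemma eigenvalue_quadratic:
  assumes "adjacency_matrix X *v f = z *s f" "(\<Sum>u\<in>UNIV. f $ u) = 0" "f \<noteq> 0"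
  shows "z\<^sup>2 = (of_nat a - of_nat c) * z + (of_nat k - of_nat c)"
proof -
  obtain u where u: "f $ u \<noteq> 0" using assms(3) by (auto simp: vec_eq_iff)
  have "z\<^sup>2 * f $ u = ((of_nat a - of_nat c) * z + (of_nat k - of_nat c)) * f $ u"
    using adjacency_matrix_square_mult_nth[of f u] assms(1,2)
    by (simp add: matrix_vector_mult_scaleR vector_scalar_commute power2_eq_square algebra_simps)
  then show ?thesis using u by simp
qed

text \<open>Inclusion-exclusion on common non-neighbours. The relations are stated additively to
  avoid truncated subtraction, and \<open>0 < k\<close> supplies an edge of X from which
  \<open>c'\<close> is read off.\<close>

lemma complement_parameters:
  assumes "0 < k"
  obtains a' c' where "strongly_regular (complement_graph X) v (v - 1 - k) a' c'"
    "v + c = a' + 2 + 2 * k" "v + a = c' + 2 * k"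
proof -
  let ?Y = "complement_graph X"
  have Y: "of_bool (?Y u z) = (1 - of_bool (z = u) - of_bool (X u z) :: int)" for u z
    using irrefl by (auto simp: complement_graph_def)
  have k': "card {z. ?Y u z} = v - 1 - k" for u
  proof -
    have "int (card {z. ?Y u z}) = (\<Sum>z\<in>UNIV. of_bool (?Y u z))" by simp
    also have "\<dots> = int v - 1 - k"
      unfolding Y sum_subtractf sum_adjacent by (simp add: card_vertices)
    finally show ?thesis by linarith
  qed
  have com: "int (card {z. ?Y u z \<and> ?Y w z}) = int v - 2 - 2 * k + 2 * of_bool (X u w) + c
      + (int a - c) * of_bool (X u w)" if "u \<noteq> w" for u w
  proof -
    have "int (card {z. ?Y u z \<and> ?Y w z}) = (\<Sum>z\<in>UNIV. of_bool (?Y u z) * of_bool (?Y w z))"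
      by (simp flip: of_bool_conj)
    \<comment> \<open>Expansion of the product of the two indicators; the term with z = u and z = w
      vanishes because u and w differ.\<close>
    also have "\<dots> = (\<Sum>z\<in>UNIV. 1 - of_bool (z = u) - of_bool (z = w) - of_bool (X u z) - of_bool (X w z)
       + of_bool (z = u) * of_bool (X w u) + of_bool (z = w) * of_bool (X u w) 
       + of_bool (X u z) * of_bool (X w z))"
      unfolding Y using that by (intro sum.cong) auto
    also have "\<dots> = int v - 2 - 2 * k + 2 * of_bool (X u w) + c + (int a - c) * of_bool (X u w)"
      unfolding sum.distrib sum_subtractf sum_adjacent sum_common sum_distrib_right[symmetric]
      using that sym[of u w] by (simp add: card_vertices)
    finally show ?thesis .
  qed
  obtain u0 w0 where n0: "u0 \<noteq> w0" "\<not> X u0 w0" using nonedge by blast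
  obtain u1 w1 where e1: "X u1 w1" using assms degree by (metis Collect_empty_eq card.empty less_irrefl)
  then have "u1 \<noteq> w1" using irrefl by auto
  let ?a = "card {z. ?Y u0 z \<and> ?Y w0 z}" and ?c = "card {z. ?Y u1 z \<and> ?Y w1 z}"
  have a: "int ?a = int v - 2 - 2 * k + c" using com n0 by simp
  have c: "int ?c = int v - 2 * k + a" using com[OF \<open>u1 \<noteq> w1\<close>] e1 by simp
  have "strongly_regular ?Y v (v - 1 - k) ?a ?c"
    unfolding strongly_regular_def
  proof (intro conjI allI impI)
    show "simple_graph ?Y" using sym by (auto simp: simple_graph_def symp_def irreflp_def complement_graph_def)
    show "\<exists>u w. u \<noteq> w \<and> \<not> ?Y u w" using e1 \<open>u1 \<noteq> w1\<close> by (auto simp: complement_graph_def)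
    show "card {z. ?Y u z \<and> ?Y w z} = ?a" if "?Y u w" for u w
    proof -
      have "int (card {z. ?Y u z \<and> ?Y w z}) = ?a"
        using com[of u w] that a by (simp add: complement_graph_def)
      then show ?thesis by simp
    qed
    show "card {z. ?Y u z \<and> ?Y w z} = ?c" if "u \<noteq> w \<and> \<not> ?Y u w" for u w
    proof -
      have "int (card {z. ?Y u z \<and> ?Y w z}) = ?c"
        using com[of u w] that c by (auto simp: complement_graph_def)
      then show ?thesis by simp
    qed
  qed (simp_all add: k' card_vertices)
  then show ?thesis using that[of ?a ?c] a c by linarith
qed

text \<open>Vieta's formulas: both numbers are roots of the quadratic since they differ from k, and
  they are distinct because of their signs.\<close>

lemma eigenvalue_relations:
  assumes "srg_eigenvalues X k \<theta> \<tau>"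
  shows "\<theta> + \<tau> = real a - real c" "\<theta> * \<tau> = real c - real k"
proof -
  have root: "t\<^sup>2 = (real a - real c) * t + (real k - real c)"
    if t: "complex_of_real t \<in> eigenvalues (adjacency_matrix X)" "t < k" for t
  proof -
    obtain f where f: "f \<noteq> 0" "adjacency_matrix X *v f = complex_of_real t *s f"
      using t(1) unfolding eigenvalues_def by blast
    have "complex_of_real t \<noteq> of_nat k" using t(2)
      by (metis less_irrefl of_real_eq_iff of_real_of_nat_eq)
    then have "(complex_of_real t)\<^sup>2 = (of_nat a - of_nat c) * of_real t + (of_nat k - of_nat c)"
      using eigenvalue_quadratic[OF f(2) eigenvector_sum[OF f(2)] f(1)] by simp
    then have "complex_of_real (t\<^sup>2) = of_real ((real a - real c) * t + (real k - real c))" by simp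
    then show ?thesis by (simp only: of_real_eq_iff)
  qed
  have \<theta>: "\<theta>\<^sup>2 = (real a - real c) * \<theta> + (real k - real c)"
    and \<tau>: "\<tau>\<^sup>2 = (real a - real c) * \<tau> + (real k - real c)"
    using assms by (auto simp: srg_eigenvalues_def intro!: root)
  then have "(\<theta> - \<tau>) * (\<theta> + \<tau>) = (\<theta> - \<tau>) * (real a - real c)"
    by (simp add: power2_eq_square algebra_simps)
  moreover have "\<theta> \<noteq> \<tau>" using assms by (auto simp: srg_eigenvalues_def)
  ultimately show sum: "\<theta> + \<tau> = real a - real c" by simp
  show "\<theta> * \<tau> = real c - real k"
    using \<theta> unfolding sum[symmetric] by (simp add: power2_eq_square algebra_simps)
qed

text \<open>The quadratic evaluated at k gives (k - \<theta>)(k - \<tau>) = vc, so the position of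
  the eigenvalues forces c > 0; a negative product \<theta>\<tau> = c - k gives c < k.\<close>

lemma positive_parameters:
  assumes "srg_eigenvalues X k \<theta> \<tau>"
  shows "0 < k" "0 < c" "c < k"
proof -
  have \<theta>\<tau>: "\<theta> < k" "0 < \<theta>" "\<tau> < 0" using assms by (auto simp: srg_eigenvalues_def)
  then have "0 < (k - \<theta>) * (k - \<tau>)" by (intro mult_pos_pos) auto
  also have "(k - \<theta>) * (k - \<tau>) = k * k - k * (\<theta> + \<tau>) + \<theta> * \<tau>" by (simp add: algebra_simps)
  also have "\<dots> = v * c"
    unfolding eigenvalue_relations[OF assms] using count by (simp add: algebra_simps)
  finally show "0 < c" by (cases "c = 0") auto
  show "0 < k" using \<theta>\<tau> by (cases "k = 0") auto
  have "\<theta> * \<tau> < 0" using \<theta>\<tau> by (simp add: mult_pos_neg)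
  then show "c < k" unfolding eigenvalue_relations[OF assms] by simp
qed

section \<open>The Hadamard condition and the constructions\<close>

text \<open>For unit x and y the diagonal of W W* is automatically v, and an off-diagonal entry
  depends only on adjacency and is real. As \<open>0 < k\<close> yields an edge and X is not
  complete, both kinds of entry occur.\<close>

lemma complex_hadamard_iff:
  fixes x y :: complex
  assumes "0 < k"
  shows "complex_hadamard (scheme_matrix X x y)
    \<longleftrightarrow> norm x = 1 \<and> norm y = 1 \<and>
      2 * Re x + real v - 2 * real k + 2 * real a + 2 * (real k - 1 - real a) * Re (x * cnj y) = 0 \<and>
      2 * Re y + real v - 2 - 2 * real k + 2 * real c + 2 * (real k - real c) * Re (x * cnj y) = 0"
    (is "complex_hadamard ?W \<longleftrightarrow> _ \<and> _ \<and> ?E = 0 \<and> ?F = 0")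
proof -
  \<comment> \<open>Indicators replace the three cases, so that the product of two rows splits into
    point masses, degree sums and a common-neighbour sum.\<close>
  have W: "?W $ u $ w = y + (1 - y) * of_bool (u = w) + (x - y) * of_bool (X u w)" for u w
    using irrefl by (auto simp: scheme_matrix_def mat_def adjacency_matrix_def complement_graph_def)
  obtain u0 w0 where n0: "u0 \<noteq> w0" "\<not> X u0 w0" using nonedge by blast
  obtain u1 w1 where e1: "X u1 w1" using assms degree by (metis Collect_empty_eq card.empty less_irrefl)
  then have "u1 \<noteq> w1" using irrefl by auto
  have "(\<forall>u w. norm (?W $ u $ w) = 1) \<longleftrightarrow> norm x = 1 \<and> norm y = 1"
  proof
    assume "\<forall>u w. norm (?W $ u $ w) = 1"
    then have "norm (?W $ u1 $ w1) = 1" "norm (?W $ u0 $ w0) = 1" by blast+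
    then show "norm x = 1 \<and> norm y = 1" unfolding W using n0 e1 \<open>u1 \<noteq> w1\<close> by simp
  next
    assume "norm x = 1 \<and> norm y = 1"
    then show "\<forall>u w. norm (?W $ u $ w) = 1" unfolding W using irrefl by (auto simp: of_bool_def)
  qed
  moreover have "?W ** transpose (map_matrix cnj ?W) = mat (of_nat CARD('n)) \<longleftrightarrow> ?E = 0 \<and> ?F = 0"
    if "norm x = 1" "norm y = 1"
  proof -
    have unit: "x * cnj x = 1" "y * cnj y = 1"
      using that by (simp_all add: complex_norm_square[symmetric])
    have re: "complex_of_real ?E = x + cnj x + of_nat v - 2 * of_nat k + 2 * of_nat a
        + (of_nat k - 1 - of_nat a) * (x * cnj y + y * cnj x)"
      "complex_of_real ?F = y + cnj y + of_nat v - 2 - 2 * of_nat k + 2 * of_nat c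
        + (of_nat k - of_nat c) * (x * cnj y + y * cnj x)"
      by (simp_all add: complex_eq_iff algebra_simps)
    have G: "(?W ** transpose (map_matrix cnj ?W)) $ u $ w =
      (if u = w then of_nat v else if X u w then complex_of_real ?E else complex_of_real ?F)" for u w
    proof -
      have "(?W ** transpose (map_matrix cnj ?W)) $ u $ w = (\<Sum>z\<in>UNIV. ?W $ u $ z * cnj (?W $ w $ z))"
        by (simp add: matrix_matrix_mult_def transpose_def)
      also have "\<dots> = (\<Sum>z\<in>UNIV. y * cnj y + y * (1 - cnj y) * of_bool (z = w)
          + y * (cnj x - cnj y) * of_bool (X w z) + (1 - y) * cnj y * of_bool (z = u)
          + (1 - y) * (1 - cnj y) * of_bool (u = w) * of_bool (z = w)
          + (1 - y) * (cnj x - cnj y) * of_bool (X u w) * of_bool (z = u)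
          + (x - y) * cnj y * of_bool (X u z) + (x - y) * (1 - cnj y) * of_bool (X u w) * of_bool (z = w)
          + (x - y) * (cnj x - cnj y) * (of_bool (X u z) * of_bool (X w z)))"
        unfolding W using sym[of w u] by (intro sum.cong) (auto simp: algebra_simps)
      also have "\<dots> = y * cnj y * of_nat v + y * (1 - cnj y) + y * (cnj x - cnj y) * of_nat k
          + (1 - y) * cnj y + (1 - y) * (1 - cnj y) * of_bool (u = w)
          + (1 - y) * (cnj x - cnj y) * of_bool (X u w) + (x - y) * cnj y * of_nat k
          + (x - y) * (1 - cnj y) * of_bool (X u w)
          + (x - y) * (cnj x - cnj y) * (of_nat c + (of_nat a - of_nat c) * of_bool (X u w)
              + (of_nat k - of_nat c) * of_bool (u = w))"
        unfolding sum.distrib sum_distrib_left[symmetric] sum_common sum_adjacent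
        by (simp add: card_vertices)
      also have "\<dots> = (if u = w then of_nat v else if X u w then complex_of_real ?E else complex_of_real ?F)"
        unfolding re using irrefl unit by (intro hadamard_gram_polynomial) auto
      finally show ?thesis .
    qed
    show ?thesis
    proof
      assume *: "?W ** transpose (map_matrix cnj ?W) = mat (of_nat CARD('n))"
      have "complex_of_real ?E = 0" using G[of u1 w1] e1 \<open>u1 \<noteq> w1\<close> unfolding * by (simp add: mat_def)
      moreover have "complex_of_real ?F = 0" using G[of u0 w0] n0 unfolding * by (simp add: mat_def)
      ultimately show "?E = 0 \<and> ?F = 0" by (simp only: of_real_eq_0_iff)
    next
      assume "?E = 0 \<and> ?F = 0"
      then show "?W ** transpose (map_matrix cnj ?W) = mat (of_nat CARD('n))"
        using G by (simp add: vec_eq_iff mat_def card_vertices)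
    qed
  qed
  ultimately show ?thesis unfolding complex_hadamard_def by blast
qed

lemma hadamard_of_listed:
  assumes "listed_parameters \<theta> v k a c" "0 < \<theta>" "5 \<le> v" "0 < k"
  shows "\<exists>x y. complex_hadamard (scheme_matrix X x y)"
proof -
  have hadamard: ?thesis
    if "norm x = 1" "norm y = 1"
      "2 * Re x + real v - 2 * real k + 2 * real a + 2 * (real k - 1 - real a) * Re (x * cnj y) = 0"
      "2 * Re y + real v - 2 - 2 * real k + 2 * real c + 2 * (real k - real c) * Re (x * cnj y) = 0"
    for x y
    unfolding complex_hadamard_iff[OF assms(4)] by (intro exI[of _ x] exI[of _ y] conjI that)
  \<comment> \<open>With y = 1 and Re x = p, also Re (x conj y) = p, and both equations become
    linear in p.\<close>
  have one: ?thesis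
    if "\<bar>p\<bar> \<le> 1" "2 * (real k - real a) * p = 2 * (real k - real a) - real v"
      "real v = 2 * (real k - real c) * (1 - p)" for p
    using that
    by (intro hadamard[of "cis (arccos p)" 1]) (simp_all add: cos_arccos_abs algebra_simps)
  \<comment> \<open>With y = conj x, Re (x conj y) = Re (x^2) = 2p^2 - 1, and a + 1 = c makes the
    two equations coincide.\<close>
  have two: ?thesis
    if "\<bar>p\<bar> \<le> 1" "a + 1 = c"
      "2 * p + real v - 2 + 4 * (real k - real c) * (p\<^sup>2 - 1) = 0" for p
  proof (rule hadamard[of "cis (arccos p)" "cis (- arccos p)"])
    have a: "real a = real c - 1" using that(2) by linarith
    have re: "Re (cis (arccos p) * cnj (cis (- arccos p))) = 2 * p\<^sup>2 - 1"
      using that(1) cos_double_cos[of "arccos p"] by (simp add: cis_cnj cis_mult cos_arccos_abs)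
    show "2 * Re (cis (arccos p)) + real v - 2 * real k + 2 * real a
        + 2 * (real k - 1 - real a) * Re (cis (arccos p) * cnj (cis (- arccos p))) = 0"
      using that(1,3) unfolding a re by (simp add: cos_arccos_abs algebra_simps)
    show "2 * Re (cis (- arccos p)) + real v - 2 - 2 * real k + 2 * real c
        + 2 * (real k - real c) * Re (cis (arccos p) * cnj (cis (- arccos p))) = 0"
      using that(1,3) unfolding re by (simp add: cos_arccos_abs algebra_simps)
  qed simp_all
  have v: "5 \<le> real v" using assms by simp
  consider "real v = 4 * \<theta>\<^sup>2" "real k = 2 * \<theta>\<^sup>2 - \<theta>" "real a = \<theta>\<^sup>2 - \<theta>" "real c = \<theta>\<^sup>2 - \<theta>"
    | "real v = 4 * \<theta>\<^sup>2" "real k = 2 * \<theta>\<^sup>2 + \<theta>" "real a = \<theta>\<^sup>2 + \<theta>" "real c = \<theta>\<^sup>2 + \<theta>"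
    | "real v = 4 * \<theta>\<^sup>2 - 1" "real k = 2 * \<theta>\<^sup>2" "real a = \<theta>\<^sup>2" "real c = \<theta>\<^sup>2"
    | "real v = 4 * \<theta>\<^sup>2 + 4 * \<theta> + 1" "real k = 2 * \<theta>\<^sup>2 + 2 * \<theta>" "real a = \<theta>\<^sup>2 + \<theta> - 1" "real c = \<theta>\<^sup>2 + \<theta>"
    | "real v = 4 * \<theta>\<^sup>2 + 4 * \<theta> + 2" "real k = 2 * \<theta>\<^sup>2 + \<theta>" "real a = \<theta>\<^sup>2 - 1" "real c = \<theta>\<^sup>2"
    using assms(1) unfolding listed_parameters_def insert_iff empty_iff prod.inject by blast
  then show ?thesis
  proof cases
    case 1
    then show ?thesis by (intro one[of "- 1"]) simp_all
  next
    case 2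
    then show ?thesis by (intro one[of "- 1"]) simp_all
  next
    case 3
    define t where "t = \<theta>\<^sup>2"
    have t: "real v = 4 * t - 1" "real k = 2 * t" "real a = t" "real c = t" using 3 by (simp_all add: t_def)
    then have "3 / 2 \<le> t" using v by simp
    \<comment> \<open>The value of p solves 2tp = 2t - v; the bound on t keeps it in
      [-1, 1].\<close>
    then show ?thesis
      by (intro one[of "1 / (2 * t) - 1"]) (simp_all add: t field_simps abs_le_iff)
  next
    case 4
    have "real (a + 1) = real c" using 4 by simp
    then have "a + 1 = c" by (simp only: of_nat_eq_iff)
    \<comment> \<open>The equation factors as (2(\<theta> + 1)p - 1)(2\<theta>p + 1) = 0; the chosen
      root lies in [0, 1] for every positive \<theta>.\<close>
    then show ?thesis using 4 assms(2)
      by (intro two[of "1 / (2 * (\<theta> + 1))"]) (auto simp: field_simps power2_eq_square)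
  next
    case 5
    have "real (a + 1) = real c" using 5 by simp
    then have "a + 1 = c" by (simp only: of_nat_eq_iff)
    \<comment> \<open>Here p = 0, that is x = i and y = -i.\<close>
    then show ?thesis using 5 by (intro two[of 0]) auto
  qed
qed

end

section \<open>The spectrum of the complement\<close>

lemma complement_mult_eigenvector:
  assumes "simple_graph X" "adjacency_matrix X *v f = z *s f" "(\<Sum>u\<in>UNIV. f $ u) = 0"
  shows "adjacency_matrix (complement_graph X) *v f = (- 1 - z) *s f"
  using assms by (simp add: vec_eq_iff complement_mult_nth algebra_simps)

text \<open>The map z to -1 - z exchanges the non-principal eigenvalues of the two graphs and
  reverses their order. What needs care is the strictness of the inequalities and that no eigenvalue
  -1 - k appears.\<close>

lemma srg_eigenvalues_complement:
  fixes \<theta> \<tau> :: real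
  assumes srg: "strongly_regular X v k a c" and ev: "srg_eigenvalues X k \<theta> \<tau>"
    and compl: "strongly_regular (complement_graph X) v k' a' c'" "k' = v - 1 - k"
      "v + c = a' + 2 + 2 * k" "v + a = c' + 2 * k"
  shows "srg_eigenvalues (complement_graph X) k' (- 1 - \<tau>) (- 1 - \<theta>)"
proof -
  interpret srg X v k a c using srg by unfold_locales
  interpret C: srg "complement_graph X" v k' a' c' using compl by unfold_locales
  note pos = positive_parameters[OF ev] and rel = eigenvalue_relations[OF ev]
  have \<theta>\<tau>: "\<theta> < k" "0 < \<theta>" "\<tau> < 0" using ev by (auto simp: srg_eigenvalues_def)
  have k': "real k' = real v - 1 - real k" and k'0: "0 < k'" using degree_less compl(2) by linarith+
  have a': "real a' = real v + real c - 2 - 2 * real k" and c': "real c' = real v + real a - 2 * real k"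
    using compl by linarith+
  have "0 < (real k - real c) * real k'" using pos k'0 by simp
  also have "\<dots> = real k * real c'"
    using count unfolding k' c' by (simp add: algebra_simps)
  finally have c'0: "0 < real c'" using pos by (simp add: zero_less_mult_iff)
  have "0 < (real v - 1 - real k) * real c" using k' k'0 pos by simp
  then have "0 < real k - 1 - real a" using pos unfolding count[symmetric] by (simp add: zero_less_mult_iff)
  also have "\<dots> = (- 1 - \<tau>) * (1 + \<theta>)" using rel by (simp add: algebra_simps)
  finally have \<tau>1: "0 < - 1 - \<tau>" using \<theta>\<tau> by (simp add: zero_less_mult_iff)
  \<comment> \<open>The product is v c', as in \<open>positive_parameters\<close>; that lemma cannot
    be applied to the complement here, since it presupposes the present claim.\<close>
  have "(real k' - (- 1 - \<tau>)) * (real k' - (- 1 - \<theta>))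
     = real k' * real k' + real k' * (2 + (\<theta> + \<tau>)) + 1 + (\<theta> + \<tau>) + \<theta> * \<tau>"
    by (simp add: algebra_simps)
  also have "\<dots> = real k' * real k' - real k' * (real a' - real c') + real c' - real k'"
    unfolding rel a' c' k' by (simp add: algebra_simps)
  also have "\<dots> = real v * real c'" using C.count by (simp add: algebra_simps)
  also have "\<dots> > 0" using c'0 degree_less by simp
  finally have less: "- 1 - \<tau> < real k'" using \<theta>\<tau> k'0 by (simp add: zero_less_mult_iff)
  let ?A = "adjacency_matrix X" and ?B = "adjacency_matrix (complement_graph X)"
  have shift: "- 1 - z \<in> eigenvalues ?B" if z: "z \<in> eigenvalues ?A" "z \<noteq> of_nat k" for z
  proof -
    obtain f where f: "f \<noteq> 0" "?A *v f = z *s f" using z(1) unfolding eigenvalues_def by blast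
    then show ?thesis
      using complement_mult_eigenvector[OF simple f(2) eigenvector_sum[OF f(2) z(2)]]
      unfolding eigenvalues_def by blast
  qed
  have \<theta>k: "complex_of_real t \<noteq> of_nat k" if "t < real k" for t
    using that by (metis less_irrefl of_real_eq_iff of_real_of_nat_eq)
  have evA: "eigenvalues ?A = {of_nat k, of_real \<theta>, of_real \<tau>}"
    using ev by (simp add: srg_eigenvalues_def)
  have "eigenvalues ?B = {of_nat k', of_real (- 1 - \<tau>), of_real (- 1 - \<theta>)}"
  proof (intro equalityI subsetI)
    fix z assume "z \<in> eigenvalues ?B"
    then obtain f where f: "f \<noteq> 0" "?B *v f = z *s f" unfolding eigenvalues_def by blast
    show "z \<in> {of_nat k', of_real (- 1 - \<tau>), of_real (- 1 - \<theta>)}"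
    proof (cases "z = of_nat k'")
      case False
      have sum0: "(\<Sum>u\<in>UNIV. f $ u) = 0" by (rule C.eigenvector_sum[OF f(2) False])
      have A: "?A *v f = (- 1 - z) *s f"
        using complement_mult_eigenvector[OF C.simple f(2) sum0] by (simp only: complement_involution[OF simple])
      \<comment> \<open>Otherwise k would be a root of the quadratic, whose value at k is vc >
        0.\<close>
      have "- 1 - z \<noteq> of_nat k"
      proof
        assume "- 1 - z = of_nat k"
        then have "(complex_of_real (real k))\<^sup>2 = (of_nat a - of_nat c) * of_nat k + (of_nat k - of_nat c)"
          using eigenvalue_quadratic[OF A sum0 f(1)] by simp
        then have "complex_of_real ((real k)\<^sup>2) = of_real ((real a - real c) * real k + (real k - real c))"
          by simp
        then have "(real k)\<^sup>2 = (real a - real c) * real k + (real k - real c)"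
          by (simp only: of_real_eq_iff)
        then have "real v * real c = 0" using count by (simp add: power2_eq_square algebra_simps)
        then show False using pos degree_less by simp
      qed
      moreover have "- 1 - z \<in> eigenvalues ?A" unfolding eigenvalues_def using A f(1) by blast
      ultimately have "- 1 - z = of_real \<theta> \<or> - 1 - z = of_real \<tau>" unfolding evA by blast
      then have "z = - 1 - of_real \<theta> \<or> z = - 1 - of_real \<tau>" by (auto simp: algebra_simps)
      then show ?thesis by auto
    qed simp
  next
    fix z :: complex assume "z \<in> {of_nat k', of_real (- 1 - \<tau>), of_real (- 1 - \<theta>)}"
    then consider "z = of_nat k'" | "z = - 1 - of_real \<tau>" | "z = - 1 - of_real \<theta>" by auto
    then show "z \<in> eigenvalues ?B"
    proof cases
      case 1
      have "?B *v (\<chi> i. 1) = z *s (\<chi> i. 1)"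
        using C.sum_adjacent[where 'a = complex] unfolding 1 by (simp add: vec_eq_iff adjacency_matrix_mult_nth)
      moreover have "(\<chi> i. 1) \<noteq> (0 :: complex^'a)" by (simp add: vec_eq_iff)
      ultimately show ?thesis unfolding eigenvalues_def by blast
    next
      case 2
      then show ?thesis using shift[of "of_real \<tau>"] \<theta>k[of \<tau>] \<theta>\<tau> evA by simp
    next
      case 3
      then show ?thesis using shift[of "of_real \<theta>"] \<theta>k[of \<theta>] \<theta>\<tau> evA by simp
    qed
  qed
  then show ?thesis using less \<tau>1 \<theta>\<tau> by (simp add: srg_eigenvalues_def)
qed

section \<open>The equivalence, by way of the Gram determinant\<close>

text \<open>This is the Gram determinant of the plane vectors \<open>1\<close>, \<open>x\<close> and \<open>y\<close>.\<close>
lemma gram_determinant: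
  assumes "norm x = 1" "norm y = 1"
  shows "1 - (Re x)\<^sup>2 - (Re y)\<^sup>2 - (Re (x * cnj y))\<^sup>2 + 2 * Re x * Re y * Re (x * cnj y) = 0"
proof -
  have x: "(Re x)\<^sup>2 = 1 - (Im x)\<^sup>2" and y: "(Re y)\<^sup>2 = 1 - (Im y)\<^sup>2"
    using assms cmod_power2[of x] cmod_power2[of y] by simp_all
  have "1 - (Re x)\<^sup>2 - (Re y)\<^sup>2 - (Re (x * cnj y))\<^sup>2 + 2 * Re x * Re y * Re (x * cnj y)
    = (1 - (Re x)\<^sup>2) * (1 - (Re y)\<^sup>2) - (Im x)\<^sup>2 * (Im y)\<^sup>2"
    by (simp add: power2_eq_square algebra_simps)
  also have "\<dots> = 0" unfolding x y by simp
  finally show ?thesis .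
qed

theorem theorem2p5:
  fixes X :: "'n::finite \<Rightarrow> 'n \<Rightarrow> bool"
    and v k a c :: nat
    and \<theta> \<tau> :: real
  assumes "strongly_regular X v k a c"
    and "primitive_graph X"
    and "v \<ge> 5"
    and "srg_eigenvalues X k \<theta> \<tau>"
  shows "(\<exists>x y :: complex.
            complex_hadamard
              (mat 1 + map_matrix ((*) x) (adjacency_matrix X)
                     + map_matrix ((*) y) (adjacency_matrix (complement_graph X))))
     \<longleftrightarrow>
         listed_parameters \<theta> v k a c \<or>
         (\<exists>k' a' c' \<theta>' \<tau>'.
            strongly_regular (complement_graph X) v k' a' c' \<and>
            srg_eigenvalues (complement_graph X) k' \<theta>' \<tau>' \<and>
            listed_parameters \<theta>' v k' a' c')"
  unfolding scheme_matrix_def[symmetric]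
proof
  interpret srg X v k a c using assms(1) by unfold_locales
  note pos = positive_parameters[OF assms(4)] and rel = eigenvalue_relations[OF assms(4)]
  have \<theta>\<tau>: "0 < \<theta>" "\<tau> < 0" using assms(4) by (auto simp: srg_eigenvalues_def)
  assume "\<exists>x y. complex_hadamard (scheme_matrix X x y)"
  then obtain x y where xy: "norm x = 1" "norm y = 1"
    "2 * Re x + real v - 2 * real k + 2 * real a + 2 * (real k - 1 - real a) * Re (x * cnj y) = 0"
    "2 * Re y + real v - 2 - 2 * real k + 2 * real c + 2 * (real k - real c) * Re (x * cnj y) = 0"
    unfolding complex_hadamard_iff[OF pos(1)] by blast
  have bnd: "\<bar>Re x\<bar> \<le> 1" "\<bar>Re y\<bar> \<le> 1" "\<bar>Re (x * cnj y)\<bar> \<le> 1"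
    using abs_Re_le_cmod[of x] abs_Re_le_cmod[of y] abs_Re_le_cmod[of "x * cnj y"] xy
    by (simp_all add: norm_mult)
  obtain a' c' where compl: "strongly_regular (complement_graph X) v (v - 1 - k) a' c'"
    "v + c = a' + 2 + 2 * k" "v + a = c' + 2 * k"
    using complement_parameters[OF pos(1)] .
  define k' where "k' = v - 1 - k"
  have ev': "srg_eigenvalues (complement_graph X) k' (- 1 - \<tau>) (- 1 - \<theta>)"
    by (rule srg_eigenvalues_complement[OF assms(1,4) compl(1)[folded k'_def] k'_def compl(2,3)])
  interpret C: srg "complement_graph X" v k' a' c' using compl(1) unfolding k'_def by unfold_locales
  note pos' = C.positive_parameters[OF ev'] and rel' = C.eigenvalue_relations[OF ev']
  have "listed_parameters \<theta> v k a c \<or> listed_parameters (- 1 - \<tau>) v k' a' c'"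
  \<comment> \<open>The condition says P <= Q. If it fails, it holds for the complement, where x and
    y trade places and the two equations are exchanged; complementing the eigenvalues twice restores
    \<theta>.\<close>
  proof (cases "c \<le> a + 1")
    case True
    show ?thesis
      using xy(3,4)
      by (intro listed_of_hadamard_equations[OF rel \<theta>\<tau> k'_def compl(2,3) degree_less pos(1,2) assms(3)
            True count even_vertices_degree bnd gram_determinant[OF xy(1,2)]]) simp_all
  next
    case False
    have k': "real k' = real v - 1 - real k" and k: "k = v - 1 - k'" using degree_less k'_def by linarith+
    have a': "real a' = real v + real c - 2 - 2 * real k" and c': "real c' = real v + real a - 2 * real k"
      using compl by linarith+
    have c1: "v + c' = a + 2 + 2 * k'" "v + a' = c + 2 * k'" "c' \<le> a' + 1"
      using compl k'_def degree_less False by linarith+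
    have sgn: "0 < - 1 - \<tau>" "- 1 - \<theta> < 0" using ev' by (auto simp: srg_eigenvalues_def)
    have "listed_parameters (- 1 - \<tau>) v k' a' c' \<or> listed_parameters (- 1 - (- 1 - \<theta>)) v k a c"
    proof (rule listed_of_hadamard_equations[OF rel' sgn k c1(1,2) C.degree_less pos'(1,2) assms(3)
            c1(3) C.count C.even_vertices_degree bnd(2,1,3)])
      show "1 - (Re y)\<^sup>2 - (Re x)\<^sup>2 - (Re (x * cnj y))\<^sup>2 + 2 * Re y * Re x * Re (x * cnj y) = 0"
        using gram_determinant[OF xy(1,2)] by (simp add: algebra_simps)
      show "2 * Re y + v - (2 * k')  + (2 * a') + 2 * (real k' - 1 - a') * Re (x * cnj y) = 0"
        using xy(4) by (simp add: k' a' algebra_simps)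
      show "2 * Re x + v - 2 - (2 * k') + (2 * c') + 2 * (real k' - c') * Re (x * cnj y) = 0"
        using xy(3) by (simp add: k' c' algebra_simps)
    qed
    then show ?thesis by auto
  qed
  then show "listed_parameters \<theta> v k a c \<or>
         (\<exists>k' a' c' \<theta>' \<tau>'.
            strongly_regular (complement_graph X) v k' a' c' \<and>
            srg_eigenvalues (complement_graph X) k' \<theta>' \<tau>' \<and>
            listed_parameters \<theta>' v k' a' c')"
    using C.srg ev' by blast
next
  interpret srg X v k a c using assms(1) by unfold_locales
  assume "listed_parameters \<theta> v k a c \<or>
         (\<exists>k' a' c' \<theta>' \<tau>'.
            strongly_regular (complement_graph X) v k' a' c' \<and>
            srg_eigenvalues (complement_graph X) k' \<theta>' \<tau>' \<and>
            listed_parameters \<theta>' v k' a' c')"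
  then show "\<exists>x y. complex_hadamard (scheme_matrix X x y)"
  proof (elim disjE exE conjE)
    assume "listed_parameters \<theta> v k a c"
    then show ?thesis
      using hadamard_of_listed positive_parameters(1)[OF assms(4)] assms(3,4)
      by (auto simp: srg_eigenvalues_def)
  next
    fix k' a' c' \<theta>' \<tau>'
    assume C: "strongly_regular (complement_graph X) v k' a' c'"
      "srg_eigenvalues (complement_graph X) k' \<theta>' \<tau>'" "listed_parameters \<theta>' v k' a' c'"
    interpret C: srg "complement_graph X" v k' a' c' using C(1) by unfold_locales
    have "0 < \<theta>'" using C(2) by (auto simp: srg_eigenvalues_def)
    then obtain x y where "complex_hadamard (scheme_matrix (complement_graph X) x y)"
      using C.hadamard_of_listed[OF C(3) _ assms(3) C.positive_parameters(1)[OF C(2)]] by blast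
    \<comment> \<open>A solution for the complement becomes one for X by interchanging the
      coefficients.\<close>
    moreover have "scheme_matrix (complement_graph X) x y = scheme_matrix X y x"
      unfolding scheme_matrix_def complement_involution[OF simple] by (simp add: add_ac)
    ultimately show ?thesis by auto
  qed
qed

end
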